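(* Let $G$ and $H$ be connected graphs such that at least one of $G$, $H$ has at least three vertices (and each has at least two vertices). Then $\chi_{lid}(G \times H) \leq \chi(G)\,\chi(H)$.
   Context: $\chi(G)$ is the chromatic number of $G$. A proper $k$-coloring of a graph $G$ is a map $f:V(G)\to\{1,\dots,k\}$ with $f(u)\neq f(v)$ for every edge $uv$. For a vertex $v$, $N[v]$ denotes its closed neighborhood ($v$ together with all its neighbors), and $f(S)=\{f(x):x\in S\}$. A locally identifying coloring (lid-coloring) of $G$ is a proper coloring $f$ such that for every edge $uv$ with $N[u]\neq N[v]$ we have $f(N[u])\neq f(N[v])$. The lid-chromatic number $\chi_{lid}(G)$ is the smallest $k$ such that $G$ has a lid-coloring with $k$ colors. The tensor product $G\times H$ has vertex set $V(G)\times V(H)$, where $(u_1,v_1)$ and $(u_2,v_2)$ are adjacent iff $u_1u_2\in E(G)$ and $v_1v_2\in E(H)$. *)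

theory Defs
  imports "Graph_Theory.Digraph_Component"
begin

text \<open>
  Finite simple graphs are modelled as instances of the locale \<^locale>\<open>pair_graph\<close>:
  finite, loop-free, symmetric digraphs whose arcs are pairs of vertices. An edge \<open>uv\<close> is
  the pair of arcs \<open>(u, v)\<close> and \<open>(v, u)\<close>.
\<close>

definition proper_coloring :: "'a pair_pre_digraph \<Rightarrow> nat \<Rightarrow> ('a \<Rightarrow> nat) \<Rightarrow> bool" where
  "proper_coloring G k f \<longleftrightarrow>
     f ` pverts G \<subseteq> {1..k} \<and> (\<forall>(u, v) \<in> parcs G. f u \<noteq> f v)"

definition chromatic_number :: "'a pair_pre_digraph \<Rightarrow> nat" where
  "chromatic_number G = (LEAST k. \<exists>f. proper_coloring G k f)"

definition closed_nbhd :: "'a pair_pre_digraph \<Rightarrow> 'a \<Rightarrow> 'a set" where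
  "closed_nbhd G v = insert v {w. (v, w) \<in> parcs G}"

definition lid_coloring :: "'a pair_pre_digraph \<Rightarrow> nat \<Rightarrow> ('a \<Rightarrow> nat) \<Rightarrow> bool" where
  "lid_coloring G k f \<longleftrightarrow>
     proper_coloring G k f \<and>
     (\<forall>(u, v) \<in> parcs G. closed_nbhd G u \<noteq> closed_nbhd G v \<longrightarrow>
        f ` closed_nbhd G u \<noteq> f ` closed_nbhd G v)"

definition lid_chromatic_number :: "'a pair_pre_digraph \<Rightarrow> nat" where
  "lid_chromatic_number G = (LEAST k. \<exists>f. lid_coloring G k f)"

definition tensor_product ::
  "'a pair_pre_digraph \<Rightarrow> 'b pair_pre_digraph \<Rightarrow> ('a \<times> 'b) pair_pre_digraph" where
  "tensor_product G H =
     \<lparr> pverts = pverts G \<times> pverts H,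
       parcs = {((u1, v1), (u2, v2)) | u1 v1 u2 v2.
                  (u1, u2) \<in> parcs G \<and> (v1, v2) \<in> parcs H} \<rparr>"

lemma pair_graph_tensor_product:
  assumes "pair_graph G" "pair_graph H"
  shows "pair_graph (tensor_product G H)"
proof -
  interpret G: pair_graph G by fact
  interpret H: pair_graph H by fact
  have sub: "parcs (tensor_product G H) \<subseteq> (pverts G \<times> pverts H) \<times> (pverts G \<times> pverts H)"
    by (auto simp: tensor_product_def dest: G.in_arcsD1 G.in_arcsD2 H.in_arcsD1 H.in_arcsD2)
  show ?thesis
  proof
    show "finite (pverts (tensor_product G H))"
      by (simp add: tensor_product_def)
    show "finite (parcs (tensor_product G H))"
      by (rule finite_subset[OF sub]) simp
    show "symmetric (with_proj (tensor_product G H))"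
      using G.sym_arcs H.sym_arcs
      by (auto simp: symmetric_def tensor_product_def sym_def)
  qed (auto simp: tensor_product_def dest: G.in_arcsD1 G.in_arcsD2 H.in_arcsD1 H.in_arcsD2 G.pair_no_loops)
qed

text \<open>
  An injective coloring is a lid-coloring, so for finite simple graphs both \<open>LEAST\<close> above range
  over nonempty sets.
\<close>

lemma lid_coloring_exists:
  assumes "pair_graph G"
  shows "\<exists>f. lid_coloring G (card (pverts G)) f"
proof -
  interpret pair_graph G by fact
  obtain f where f: "bij_betw f (pverts G) {1..card (pverts G)}"
    using finite_same_card_bij[of "pverts G" "{1..card (pverts G)}"] by auto
  then have inj: "inj_on f (pverts G)" and im: "f ` pverts G = {1..card (pverts G)}"
    by (auto simp: bij_betw_def)
  have nb: "closed_nbhd G v \<subseteq> pverts G" if "v \<in> pverts G" for v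
    using that in_arcsD2 by (auto simp: closed_nbhd_def)
  have "lid_coloring G (card (pverts G)) f"
    unfolding lid_coloring_def proper_coloring_def
  proof (intro conjI ballI)
    fix e assume "e \<in> parcs G"
    moreover obtain u v where e: "e = (u, v)" by force
    ultimately have uv: "u \<in> pverts G" "v \<in> pverts G" "u \<noteq> v"
      using in_arcsD1 in_arcsD2 pair_no_loops[of e] by auto
    show "case e of (u, v) \<Rightarrow> f u \<noteq> f v"
      using uv inj e by (auto dest: inj_onD)
    show "case e of (u, v) \<Rightarrow> closed_nbhd G u \<noteq> closed_nbhd G v \<longrightarrow>
        f ` closed_nbhd G u \<noteq> f ` closed_nbhd G v"
      using inj_on_image_eq_iff[OF inj nb nb] uv e by simp
  qed (use im in simp)
  then show ?thesis by blast
qed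

end

theory Submission
  imports Defs
begin

text \<open>
  Both cases of the proof place vertices on levels such that neighbours are on consecutive levels
  and every vertex outside a starting set has a neighbour one level below. If \<open>v\<close> is a neighbour
  of such a vertex \<open>u\<close> one level above, then \<open>u\<close> sees the level below its own, which modulo 4
  does not occur around \<open>v\<close>.

  If a factor is bipartite, so is the product, and every bipartite graph has a lid-coloring with
  four colors: take the distance modulo 4 to a vertex \<open>r\<close> of minimum degree in each component.
  A neighbour of \<open>r\<close> is on level 1 and, unless it has the same closed neighbourhood as \<open>r\<close>, has
  a neighbour on level 2, which \<open>r\<close> does not see.

  Otherwise both chromatic numbers are at least 3. The product of two optimal colorings
  \<open>f\<close> and \<open>g\<close> need not be a lid-coloring (in the product of two 5-cycles it never is).
  Take \<open>f\<close> and \<open>g\<close> greedy, i.e. every vertex sees all colors below its own. Then only edges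
  inside \<open>S = X \<times> Y\<close> can fail to be distinguished, where \<open>X\<close> and \<open>Y\<close> consist of the vertices
  whose closed neighbourhood uses colors 1 and 2 only. The set \<open>S\<close> is recolored by levels
  modulo 4 grown inwards from its complement: levels 0 and 1 keep the product color, level 2 gets
  \<open>(3, 3)\<close> and level 3 gets \<open>(1, g v)\<close>. Vertices of \<open>S\<close> with a neighbour outside are
  on levels 1 and 2, so that the complement of \<open>S\<close> only sees the new color \<open>(3, 3)\<close>.
\<close>

section \<open>Distance to a set along a relation\<close>

definition dist_to :: "'a rel \<Rightarrow> 'a set \<Rightarrow> 'a \<Rightarrow> nat" where
  "dist_to E A v = (LEAST n. \<exists>a\<in>A. (v, a) \<in> E ^^ n)"

lemma dist_to_le: "a \<in> A \<Longrightarrow> (v, a) \<in> E ^^ n \<Longrightarrow> dist_to E A v \<le> n"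
  unfolding dist_to_def by (rule Least_le) blast

lemma dist_to_attained:
  assumes "(v, a) \<in> E\<^sup>*" "a \<in> A"
  shows "\<exists>a\<in>A. (v, a) \<in> E ^^ dist_to E A v"
proof -
  have "\<exists>n. \<exists>a\<in>A. (v, a) \<in> E ^^ n"
    using rtrancl_imp_relpow[OF assms(1)] assms(2) by blast
  then show ?thesis
    unfolding dist_to_def by (rule LeastI_ex)
qed

lemma dist_to_le_Suc:
  assumes "(u, v) \<in> E" "(v, a) \<in> E\<^sup>*" "a \<in> A"
  shows "dist_to E A u \<le> Suc (dist_to E A v)"
  using dist_to_attained[OF assms(2,3)] relpow_Suc_I2[OF assms(1)] dist_to_le by metis

lemma dist_to_eq_Suc:
  assumes "(u, a) \<in> E\<^sup>*" "a \<in> A" "u \<notin> A"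
  obtains v where "(u, v) \<in> E" "dist_to E A u = Suc (dist_to E A v)"
proof -
  obtain b where b: "b \<in> A" "(u, b) \<in> E ^^ dist_to E A u"
    using dist_to_attained[OF assms(1,2)] by blast
  then obtain n where n: "dist_to E A u = Suc n"
    using assms(3) by (cases "dist_to E A u") auto
  then obtain v where v: "(u, v) \<in> E" "(v, b) \<in> E ^^ n"
    using b(2) relpow_Suc_D2 by metis
  have "dist_to E A v \<le> n"
    using dist_to_le b(1) v(2) by fast
  moreover have "dist_to E A u \<le> Suc (dist_to E A v)"
    using dist_to_le_Suc v b(1) relpow_imp_rtrancl by metis
  ultimately show ?thesis
    using that v(1) n by simp
qed

section \<open>Graphs and colorings\<close>

lemma (in pair_sym_digraph) connected_rtrancl:
  assumes "Digraph_Component.connected (with_proj G)" "u \<in> pverts G" "v \<in> pverts G"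
  shows "(u, v) \<in> (parcs G)\<^sup>*"
proof -
  have "strongly_connected (with_proj G)"
    using symmetric_connected_imp_strongly_connected[OF sym_arcs assms(1)] .
  then have "u \<rightarrow>\<^sup>*\<^bsub>with_proj G\<^esub> v"
    using assms(2,3) by (auto simp: strongly_connected_def)
  then show ?thesis
    using reachable_rtranclI by force
qed

lemma (in pair_sym_digraph) connected_has_neighbour:
  assumes "Digraph_Component.connected (with_proj G)" "card (pverts G) \<ge> 2" "v \<in> pverts G"
  shows "\<exists>w. (v, w) \<in> parcs G"
proof -
  have "pverts G \<noteq> {v}"
    using assms(2) by auto
  then obtain u where "u \<in> pverts G" "u \<noteq> v"
    using assms(3) by blast
  then show ?thesis
    using connected_rtrancl[OF assms(1,3)] by (metis converse_rtranclE)
qed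

lemma (in pair_sym_digraph) rtrancl_arcs_sym: "(u, v) \<in> (parcs G)\<^sup>* \<Longrightarrow> (v, u) \<in> (parcs G)\<^sup>*"
  using arcs_symmetric by (meson symD symI sym_rtrancl)

lemma (in pair_wf_digraph) closed_nbhd_subset: "v \<in> pverts G \<Longrightarrow> closed_nbhd G v \<subseteq> pverts G"
  using in_arcsD2 by (auto simp: closed_nbhd_def)

lemma proper_coloring_range: "proper_coloring G k f \<Longrightarrow> v \<in> pverts G \<Longrightarrow> f v \<in> {1..k}"
  by (auto simp: proper_coloring_def)

lemma proper_coloring_arc: "proper_coloring G k f \<Longrightarrow> (u, v) \<in> parcs G \<Longrightarrow> f u \<noteq> f v"
  by (auto simp: proper_coloring_def)

lemma (in pair_graph) proper_coloring_chromatic_number: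
  "\<exists>f. proper_coloring G (chromatic_number G) f"
  unfolding chromatic_number_def
  by (rule LeastI_ex) (use lid_coloring_exists[of G] in \<open>auto simp: lid_coloring_def\<close>)

lemma chromatic_number_le: "proper_coloring G k f \<Longrightarrow> chromatic_number G \<le> k"
  unfolding chromatic_number_def by (rule Least_le) blast

lemma (in pair_graph) chromatic_number_ge_2:
  assumes "(u, v) \<in> parcs G"
  shows "chromatic_number G \<ge> 2"
proof -
  obtain f where f: "proper_coloring G (chromatic_number G) f"
    using proper_coloring_chromatic_number by blast
  then have "f u \<in> {1..chromatic_number G}" "f v \<in> {1..chromatic_number G}" "f u \<noteq> f v"
    using assms proper_coloring_range[OF f] proper_coloring_arc[OF f] in_arcsD1 in_arcsD2 by blast+
  then show ?thesis
    by auto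
qed

lemma (in pair_graph) lid_chromatic_number_le_card:
  assumes C: "finite C" "c ` pverts G \<subseteq> C"
    and proper: "\<And>u v. (u, v) \<in> parcs G \<Longrightarrow> c u \<noteq> c v"
    and lid: "\<And>u v. (u, v) \<in> parcs G \<Longrightarrow> closed_nbhd G u \<noteq> closed_nbhd G v \<Longrightarrow>
      c ` closed_nbhd G u \<noteq> c ` closed_nbhd G v"
  shows "lid_chromatic_number G \<le> card C"
proof -
  obtain h where "bij_betw h C {1..card C}"
    using finite_same_card_bij[of C "{1..card C}"] C by auto
  then have inj: "inj_on h C" and im: "h ` C = {1..card C}"
    by (auto simp: bij_betw_def)
  have nbhd: "c ` closed_nbhd G v \<subseteq> C" if "v \<in> pverts G" for v
    using closed_nbhd_subset[OF that] C(2) by blast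
  have "h (c u) \<noteq> h (c v)" if "(u, v) \<in> parcs G" for u v
    using inj_on_eq_iff[OF inj, of "c u" "c v"] proper[OF that] C(2)
      in_arcsD1[OF that] in_arcsD2[OF that] by blast
  moreover have "(h \<circ> c) ` pverts G \<subseteq> {1..card C}"
    using C(2) im by auto
  moreover have "h ` c ` closed_nbhd G u \<noteq> h ` c ` closed_nbhd G v"
    if uv: "(u, v) \<in> parcs G" and "closed_nbhd G u \<noteq> closed_nbhd G v" for u v
    using inj_on_image_eq_iff[OF inj nbhd[OF in_arcsD1[OF uv]] nbhd[OF in_arcsD2[OF uv]]]
      lid that by simp
  ultimately have "lid_coloring G (card C) (h \<circ> c)"
    unfolding lid_coloring_def proper_coloring_def image_comp comp_apply by blast
  then show ?thesis
    unfolding lid_chromatic_number_def by (blast intro: Least_le)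
qed

section \<open>Levels\<close>

lemma mod_neq_mod_if_diff_less:
  fixes m n k :: nat
  assumes "m < n" "n - m < k"
  shows "m mod k \<noteq> n mod k"
proof
  assume "m mod k = n mod k"
  then have "k dvd n - m"
    using assms(1) by (metis less_imp_le mod_eq_dvd_iff_nat)
  then show False
    using assms by (simp add: nat_dvd_not_less)
qed

definition levelling :: "'a pair_pre_digraph \<Rightarrow> 'a set \<Rightarrow> ('a \<Rightarrow> nat) \<Rightarrow> bool" where
  "levelling G S L \<longleftrightarrow> (\<forall>u\<in>S.
     (\<forall>v. (u, v) \<in> parcs G \<longrightarrow> L v = Suc (L u) \<or> L u = Suc (L v)) \<and>
     (\<exists>v. (u, v) \<in> parcs G \<and> L u = Suc (L v)))"

lemma levelling_arc:
  "levelling G S L \<Longrightarrow> u \<in> S \<Longrightarrow> (u, v) \<in> parcs G \<Longrightarrow> L v = Suc (L u) \<or> L u = Suc (L v)"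
  by (simp add: levelling_def)

lemma levelling_pos: "levelling G S L \<Longrightarrow> u \<in> S \<Longrightarrow> L u > 0"
  by (auto simp: levelling_def)

lemma levelling_mod_4_arc:
  assumes "levelling G S L" "u \<in> S" "(u, v) \<in> parcs G"
  shows "L u mod 4 \<noteq> L v mod 4"
  using levelling_arc[OF assms] mod_neq_mod_if_diff_less[of "L u" "L v" 4]
    mod_neq_mod_if_diff_less[of "L v" "L u" 4] by auto

lemma levelling_mod_4_closed_nbhd:
  assumes lev: "levelling G S L" and S: "u \<in> S" "v \<in> S"
    and arcs: "(u, v) \<in> parcs G" "(v, u) \<in> parcs G"
  shows "(\<lambda>x. L x mod 4) ` closed_nbhd G u \<noteq> (\<lambda>x. L x mod 4) ` closed_nbhd G v"
proof -
  have upwards: "(\<lambda>x. L x mod 4) ` closed_nbhd G p \<noteq> (\<lambda>x. L x mod 4) ` closed_nbhd G q"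
    if p: "p \<in> S" and q: "q \<in> S" and above: "L q = Suc (L p)" for p q
  proof -
    obtain t where t: "(p, t) \<in> parcs G" "L p = Suc (L t)"
      using lev p by (auto simp: levelling_def)
    have "L t mod 4 \<noteq> L x mod 4" if "x \<in> closed_nbhd G q" for x
    proof -
      have "L t < L x" "L x - L t < 4"
        using that levelling_arc[OF lev q, of x] above t(2) by (auto simp: closed_nbhd_def)
      then show ?thesis
        by (rule mod_neq_mod_if_diff_less)
    qed
    moreover have "t \<in> closed_nbhd G p"
      using t(1) by (simp add: closed_nbhd_def)
    ultimately show ?thesis
      by blast
  qed
  show ?thesis
    using levelling_arc[OF lev S(1) arcs(1)] upwards[OF S] upwards[OF S(2,1)] by metis
qed

lemma (in pair_sym_digraph) levelling_exists:
  assumes reach: "\<And>v. v \<in> S \<Longrightarrow> \<exists>r. r \<notin> S \<and> (v, r) \<in> (parcs G)\<^sup>*"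
    and alternate: "\<And>u v. u \<in> S \<Longrightarrow> (u, v) \<in> parcs G \<Longrightarrow> P u \<noteq> P v"
  obtains L where "levelling G S L" "\<And>v. odd (L v) \<longleftrightarrow> P v" "\<And>v. v \<notin> S \<Longrightarrow> L v \<le> 1"
proof
  define d where "d = dist_to (parcs G) (- S)"
  define L where "L v = d v + of_bool (odd (d v) \<noteq> P v)" for v
  have reach': "\<exists>r\<in>- S. (v, r) \<in> (parcs G)\<^sup>*" for v
    using reach[of v] by (cases "v \<in> S") auto
  have d_le: "d u \<le> Suc (d v)" if "(u, v) \<in> parcs G" for u v
    using reach'[of v] dist_to_le_Suc[OF that] unfolding d_def by blast
  show odd_L: "odd (L v) \<longleftrightarrow> P v" for v
    by (auto simp: L_def)
  show "levelling G S L"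
    unfolding levelling_def
  proof (intro ballI conjI allI impI)
    fix u v assume "u \<in> S" and uv: "(u, v) \<in> parcs G"
    then have "odd (L u) \<noteq> odd (L v)"
      using alternate odd_L by simp
    then have "L u \<noteq> L v" "L u \<noteq> L v + 2" "L v \<noteq> L u + 2"
      by auto
    moreover have "L u \<le> L v + 2" "L v \<le> L u + 2"
      using d_le[OF uv] d_le[OF arcs_symmetric[OF uv]] by (simp_all add: L_def)
    ultimately show "L v = Suc (L u) \<or> L u = Suc (L v)"
      by linarith
  next
    fix u assume u: "u \<in> S"
    obtain r where "(u, r) \<in> (parcs G)\<^sup>*" "r \<in> - S"
      using reach' by blast
    then obtain v where v: "(u, v) \<in> parcs G" "d u = Suc (d v)"
      using dist_to_eq_Suc[of u r "parcs G" "- S"] u unfolding d_def by blast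
    then show "\<exists>v. (u, v) \<in> parcs G \<and> L u = Suc (L v)"
      using alternate[OF u v(1)] by (intro exI[of _ v]) (auto simp: L_def)
  qed
  show "L v \<le> 1" if "v \<notin> S" for v
    using dist_to_le[of v "- S" v 0] that by (auto simp: L_def d_def)
qed

section \<open>Bipartite graphs\<close>

definition (in pair_sym_digraph) component_root :: "'a \<Rightarrow> 'a" where
  "component_root v = (ARG_MIN (\<lambda>r. card (closed_nbhd G r)) r. (v, r) \<in> (parcs G)\<^sup>*)"

lemma (in pair_sym_digraph) rtrancl_component_root: "(v, component_root v) \<in> (parcs G)\<^sup>*"
  unfolding component_root_def by (rule arg_min_natI) (rule rtrancl_refl)

lemma (in pair_sym_digraph) card_closed_nbhd_component_root_le:
  "(v, r) \<in> (parcs G)\<^sup>* \<Longrightarrow> card (closed_nbhd G (component_root v)) \<le> card (closed_nbhd G r)"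
  unfolding component_root_def by (rule arg_min_nat_le)

lemma (in pair_sym_digraph) component_root_eq:
  assumes "(u, v) \<in> (parcs G)\<^sup>*"
  shows "component_root u = component_root v"
proof -
  have "(u, r) \<in> (parcs G)\<^sup>* \<longleftrightarrow> (v, r) \<in> (parcs G)\<^sup>*" for r
    using assms rtrancl_arcs_sym by (meson rtrancl_trans)
  then show ?thesis
    by (simp add: component_root_def)
qed

definition (in pair_sym_digraph) non_roots :: "'a set" where
  "non_roots = {v. component_root v \<noteq> v}"

lemma (in pair_sym_digraph) reaches_root: "\<exists>r. r \<notin> non_roots \<and> (v, r) \<in> (parcs G)\<^sup>*"
  using rtrancl_component_root[of v] component_root_eq[OF rtrancl_component_root[of v]]
  by (intro exI[of _ "component_root v"]) (simp add: non_roots_def)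

lemma (in pair_sym_digraph) reachable_from_root_in_non_roots:
  assumes "(r, v) \<in> (parcs G)\<^sup>*" "r \<notin> non_roots" "v \<noteq> r"
  shows "v \<in> non_roots"
  using component_root_eq[OF assms(1)] assms(2,3) by (auto simp: non_roots_def)

lemma (in pair_graph) neighbour_of_root_has_non_root_neighbour:
  assumes r: "r \<notin> non_roots" and rv: "(r, v) \<in> parcs G"
    and neq: "closed_nbhd G r \<noteq> closed_nbhd G v"
  obtains w where "(v, w) \<in> parcs G" "w \<in> non_roots"
proof -
  have "finite (closed_nbhd G r)"
    using closed_nbhd_subset[OF in_arcsD1[OF rv]] pair_finite_verts by (rule finite_subset)
  moreover have "card (closed_nbhd G r) \<le> card (closed_nbhd G v)"
    using card_closed_nbhd_component_root_le[of r v] r rv by (auto simp: non_roots_def)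
  ultimately obtain w where "w \<in> closed_nbhd G v" "w \<notin> closed_nbhd G r"
    using card_seteq[of "closed_nbhd G r" "closed_nbhd G v"] neq by blast
  then have w: "(v, w) \<in> parcs G" "w \<noteq> r"
    using rv by (auto simp: closed_nbhd_def)
  moreover have "(r, w) \<in> (parcs G)\<^sup>*"
    using rv w(1) by (blast intro: converse_rtrancl_into_rtrancl)
  ultimately show ?thesis
    using that reachable_from_root_in_non_roots[of r w] r by blast
qed

lemma (in pair_graph) ex_levelling_from_roots_if_bipartite:
  assumes f: "proper_coloring G 2 f"
  obtains L where "levelling G non_roots L" "\<And>r. r \<notin> non_roots \<Longrightarrow> L r = 0"
proof -
  define P where "P v \<longleftrightarrow> odd (f v) \<noteq> odd (f (component_root v))" for v
  obtain L where L: "levelling G non_roots L" "\<And>v. odd (L v) \<longleftrightarrow> P v"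
    "\<And>v. v \<notin> non_roots \<Longrightarrow> L v \<le> 1"
  proof (rule levelling_exists[where S = non_roots and P = P])
    show "P u \<noteq> P v" if uv: "(u, v) \<in> parcs G" for u v
    proof -
      have "f u \<in> {1..2}" "f v \<in> {1..2}"
        using proper_coloring_range[OF f] in_arcsD1[OF uv] in_arcsD2[OF uv] by blast+
      then have "odd (f u) \<noteq> odd (f v)"
        using proper_coloring_arc[OF f uv] by (auto simp: le_Suc_eq numeral_2_eq_2)
      moreover have "component_root u = component_root v"
        using component_root_eq uv by blast
      ultimately show ?thesis
        by (auto simp: P_def)
    qed
  qed (use reaches_root in blast)+
  have "L r = 0" if "r \<notin> non_roots" for r
    using L(2)[of r] L(3)[OF that] that by (cases "L r") (auto simp: P_def non_roots_def)
  then show ?thesis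
    using that L(1) by blast
qed

lemma (in pair_graph) levelling_from_roots_lid_at_root:
  assumes lev: "levelling G non_roots L" and root_level: "\<And>r. r \<notin> non_roots \<Longrightarrow> L r = 0"
    and r: "r \<notin> non_roots" and rv: "(r, v) \<in> parcs G"
    and neq: "closed_nbhd G r \<noteq> closed_nbhd G v"
  shows "(\<lambda>x. L x mod 4) ` closed_nbhd G r \<noteq> (\<lambda>x. L x mod 4) ` closed_nbhd G v"
proof -
  have neighbour: "x \<in> non_roots" "L x = 1" if "(r, x) \<in> parcs G" for x
  proof -
    show "x \<in> non_roots"
      using reachable_from_root_in_non_roots[of r x] r that no_loops'[OF that] by blast
    then show "L x = 1"
      using levelling_arc[OF lev _ arcs_symmetric[OF that]] root_level[OF r] by auto
  qed
  obtain w where w: "(v, w) \<in> parcs G" "w \<in> non_roots"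
    using neighbour_of_root_has_non_root_neighbour[OF r rv neq] by blast
  then have "L w = 2"
    using levelling_arc[OF lev neighbour(1)[OF rv] w(1)] levelling_pos[OF lev w(2)]
      neighbour(2)[OF rv] by auto
  moreover have "w \<in> closed_nbhd G v"
    using w(1) by (simp add: closed_nbhd_def)
  ultimately have "2 \<in> (\<lambda>x. L x mod 4) ` closed_nbhd G v"
    by (intro image_eqI[of _ _ w]) simp_all
  moreover have "2 \<notin> (\<lambda>x. L x mod 4) ` closed_nbhd G r"
    using neighbour(2) root_level[OF r] by (auto simp: closed_nbhd_def)
  ultimately show ?thesis
    by blast
qed

lemma (in pair_graph) lid_chromatic_number_le_4_if_bipartite:
  assumes "proper_coloring G 2 f"
  shows "lid_chromatic_number G \<le> 4"
proof -
  obtain L where lev: "levelling G non_roots L" and root_level: "\<And>r. r \<notin> non_roots \<Longrightarrow> L r = 0"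
    using ex_levelling_from_roots_if_bipartite[OF assms] by blast
  have "lid_chromatic_number G \<le> card {..<4::nat}"
  proof (rule lid_chromatic_number_le_card[where c = "\<lambda>v. L v mod 4"])
    fix u v assume uv: "(u, v) \<in> parcs G"
    note vu = arcs_symmetric[OF uv]
    have "u \<in> non_roots \<or> v \<in> non_roots"
      using reachable_from_root_in_non_roots[of u v] uv no_loops'[OF uv] by blast
    then show "L u mod 4 \<noteq> L v mod 4"
      using levelling_mod_4_arc[OF lev _ uv] levelling_mod_4_arc[OF lev _ vu] by metis
    assume "closed_nbhd G u \<noteq> closed_nbhd G v"
    then show "(\<lambda>x. L x mod 4) ` closed_nbhd G u \<noteq> (\<lambda>x. L x mod 4) ` closed_nbhd G v"
      using levelling_from_roots_lid_at_root[OF lev root_level _ uv]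
        levelling_from_roots_lid_at_root[OF lev root_level _ vu]
        levelling_mod_4_closed_nbhd[OF lev _ _ uv vu] by metis
  qed auto
  then show ?thesis
    by simp
qed

section \<open>Greedy colorings\<close>

definition greedy_coloring :: "'a pair_pre_digraph \<Rightarrow> nat \<Rightarrow> ('a \<Rightarrow> nat) \<Rightarrow> bool" where
  "greedy_coloring G k f \<longleftrightarrow> proper_coloring G k f \<and>
     (\<forall>v\<in>pverts G. \<forall>j\<in>{1..<f v}. \<exists>w. (v, w) \<in> parcs G \<and> f w = j)"

lemma (in pair_bidirected_digraph) proper_coloring_fun_upd:
  assumes f: "proper_coloring G k f" and "j \<in> {1..k}"
    and free: "\<And>w. (v, w) \<in> parcs G \<Longrightarrow> f w \<noteq> j"
  shows "proper_coloring G k (f(v := j))"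
proof -
  have "(f(v := j)) x \<noteq> (f(v := j)) y" if xy: "(x, y) \<in> parcs G" for x y
    using proper_coloring_arc[OF f xy] free[of x] free[of y] xy arcs_symmetric[OF xy]
      no_loops'[OF xy] by auto
  moreover have "(f(v := j)) ` pverts G \<subseteq> {1..k}"
    using proper_coloring_range[OF f] assms(2) by (auto simp: image_subset_iff)
  ultimately show ?thesis
    unfolding proper_coloring_def by blast
qed

lemma (in pair_graph) greedy_coloring_exists:
  assumes "proper_coloring G k f"
  shows "\<exists>f. greedy_coloring G k f"
proof -
  obtain f where f: "proper_coloring G k f"
    and min: "\<And>f'. proper_coloring G k f' \<Longrightarrow> sum f (pverts G) \<le> sum f' (pverts G)"
    using ex_has_least_nat[of "proper_coloring G k" _ "\<lambda>f. sum f (pverts G)"] assms by blast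
  have "\<exists>w. (v, w) \<in> parcs G \<and> f w = j" if v: "v \<in> pverts G" and j: "j \<in> {1..<f v}" for v j
  proof (rule ccontr)
    assume "\<nexists>w. (v, w) \<in> parcs G \<and> f w = j"
    then have "proper_coloring G k (f(v := j))"
      using proper_coloring_range[OF f v] j by (intro proper_coloring_fun_upd[OF f]) auto
    then have "sum f (pverts G) \<le> sum (f(v := j)) (pverts G)"
      by (rule min)
    moreover have "sum (f(v := j)) (pverts G) < sum f (pverts G)"
      by (rule sum_strict_mono_ex1) (use v j pair_finite_verts in auto)
    ultimately show False
      by simp
  qed
  then show ?thesis
    using f by (auto simp: greedy_coloring_def)
qed

definition two_colored_part :: "'a pair_pre_digraph \<Rightarrow> ('a \<Rightarrow> nat) \<Rightarrow> 'a set" where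
  "two_colored_part G f = {v \<in> pverts G. f ` closed_nbhd G v \<subseteq> {1, 2}}"

lemma two_colored_partD: "v \<in> two_colored_part G f \<Longrightarrow> w \<in> closed_nbhd G v \<Longrightarrow> f w \<in> {1, 2}"
  by (auto simp: two_colored_part_def)

lemma two_colored_part_neq_pverts:
  assumes "proper_coloring G k f" "chromatic_number G > 2"
  shows "two_colored_part G f \<noteq> pverts G"
proof
  assume "two_colored_part G f = pverts G"
  then have "f ` pverts G \<subseteq> {1..2}"
    using two_colored_partD[of _ G f] by (fastforce simp: closed_nbhd_def)
  then have "proper_coloring G 2 f"
    using assms(1) by (auto simp: proper_coloring_def)
  then show False
    using chromatic_number_le assms(2) by fastforce
qed

lemma (in pair_wf_digraph) ex_neighbour_color_ge_3:
  assumes f: "proper_coloring G k f"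
    and v: "v \<in> pverts G" "v \<notin> two_colored_part G f" "f v \<le> 2"
  obtains w where "(v, w) \<in> parcs G" "f w \<ge> 3"
proof -
  obtain w where w: "w \<in> closed_nbhd G v" "f w \<notin> {1, 2}"
    using v(1,2) by (auto simp: two_colored_part_def)
  then have "f w \<ge> 3"
    using proper_coloring_range[OF f, of w] closed_nbhd_subset[OF v(1)] by force
  then show ?thesis
    using that w(1) v(3) by (auto simp: closed_nbhd_def)
qed

lemma (in pair_graph) greedy_distinguishing_neighbour:
  assumes f: "greedy_coloring G k f" and uv: "(u, v) \<in> parcs G"
    and outside: "u \<notin> two_colored_part G f \<or> v \<notin> two_colored_part G f"
  obtains (at_u) n where "n \<notin> two_colored_part G f" "(u, n) \<in> parcs G" "f n \<noteq> f v"
  | (at_v) n where "n \<notin> two_colored_part G f" "(v, n) \<in> parcs G" "f n \<noteq> f u"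
proof -
  have proper: "proper_coloring G k f"
    using f by (simp add: greedy_coloring_def)
  have neighbour_of_high_color: "\<exists>n. n \<notin> two_colored_part G f \<and> (x, n) \<in> parcs G \<and> f n \<noteq> c"
    if x: "x \<in> pverts G" "f x \<ge> 3" for x c
  proof -
    obtain j where j: "j \<in> {1, 2}" "j \<noteq> c"
      by (cases "c = 1") auto
    then obtain n where n: "(x, n) \<in> parcs G" "f n = j"
      using f x by (fastforce simp: greedy_coloring_def)
    then have "n \<notin> two_colored_part G f"
      using two_colored_partD[of n G f x] arcs_symmetric x(2)
      by (auto simp: closed_nbhd_def)
    then show ?thesis
      using n j(2) by blast
  qed
  have neighbour_of_low_color: "\<exists>n. n \<notin> two_colored_part G f \<and> (x, n) \<in> parcs G \<and> f n \<noteq> f y"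
    if x: "x \<in> pverts G" "x \<notin> two_colored_part G f" "f x \<le> 2" and y: "f y \<le> 2" for x y
  proof -
    obtain n where n: "(x, n) \<in> parcs G" "f n \<ge> 3"
      using ex_neighbour_color_ge_3[OF proper x] by blast
    then have "n \<notin> two_colored_part G f"
      using two_colored_partD[of n G f n] by (auto simp: closed_nbhd_def)
    then show ?thesis
      using n y by (intro exI[of _ n]) simp
  qed
  consider "f u \<ge> 3" | "f v \<ge> 3" | "f u \<le> 2" "f v \<le> 2"
    by linarith
  then show ?thesis
    using neighbour_of_high_color neighbour_of_low_color outside at_u at_v
      in_arcsD1[OF uv] in_arcsD2[OF uv] by cases metis+
qed

section \<open>Tensor products\<close>

lemma tensor_product_arc_iff [simp]:
  "(p, q) \<in> parcs (tensor_product G H) \<longleftrightarrow>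
     (fst p, fst q) \<in> parcs G \<and> (snd p, snd q) \<in> parcs H"
  by (cases p; cases q) (auto simp: tensor_product_def)

lemma pverts_tensor_product [simp]: "pverts (tensor_product G H) = pverts G \<times> pverts H"
  by (simp add: tensor_product_def)

lemma closed_nbhd_tensor_productD:
  assumes "q \<in> closed_nbhd (tensor_product G H) p"
  shows "fst q \<in> closed_nbhd G (fst p)" "snd q \<in> closed_nbhd H (snd p)"
  using assms by (auto simp: closed_nbhd_def)

lemma proper_coloring_tensor_product_fst:
  "proper_coloring G k f \<Longrightarrow> proper_coloring (tensor_product G H) k (f \<circ> fst)"
  by (force simp: proper_coloring_def)

lemma proper_coloring_tensor_product_snd:
  "proper_coloring H k g \<Longrightarrow> proper_coloring (tensor_product G H) k (g \<circ> snd)"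
  by (force simp: proper_coloring_def)

lemma tensor_product_rtrancl_lift:
  assumes "(a, a') \<in> (parcs G)\<^sup>*" "b \<in> pverts H" and H: "pair_wf_digraph H"
    and neighbour: "\<And>v. v \<in> pverts H \<Longrightarrow> \<exists>w. (v, w) \<in> parcs H"
  shows "\<exists>b'\<in>pverts H. ((a, b), (a', b')) \<in> (parcs (tensor_product G H))\<^sup>*"
proof -
  interpret H: pair_wf_digraph H by fact
  show ?thesis
    using assms(1)
  proof induction
    case base
    show ?case
      using assms(2) by blast
  next
    case (step x y)
    then obtain b' where b': "b' \<in> pverts H" "((a, b), (x, b')) \<in> (parcs (tensor_product G H))\<^sup>*"
      by blast
    obtain b'' where b'': "(b', b'') \<in> parcs H"
      using neighbour b'(1) by blast
    have "((a, b), (y, b'')) \<in> (parcs (tensor_product G H))\<^sup>*"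
      by (rule rtrancl_into_rtrancl[OF b'(2)]) (use step b'' in simp)
    then show ?case
      using H.in_arcsD2[OF b''] by blast
  qed
qed

lemma lid_chromatic_number_tensor_product_le_4_if_bipartite:
  assumes "pair_graph G" "pair_graph H" and "chromatic_number G = 2 \<or> chromatic_number H = 2"
  shows "lid_chromatic_number (tensor_product G H) \<le> 4"
proof -
  interpret T: pair_graph "tensor_product G H"
    using assms(1,2) by (rule pair_graph_tensor_product)
  have "\<exists>c. proper_coloring (tensor_product G H) 2 c"
    using pair_graph.proper_coloring_chromatic_number[OF assms(1)]
      pair_graph.proper_coloring_chromatic_number[OF assms(2)] assms(3)
      proper_coloring_tensor_product_fst proper_coloring_tensor_product_snd by metis
  then show ?thesis
    using T.lid_chromatic_number_le_4_if_bipartite by blast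
qed

locale greedy_coloring_pair = G: pair_graph G + H: pair_graph H
  for G :: "'a pair_pre_digraph" and H :: "'b pair_pre_digraph" +
  fixes k l :: nat and f :: "'a \<Rightarrow> nat" and g :: "'b \<Rightarrow> nat"
  assumes greedy_f: "greedy_coloring G k f" and greedy_g: "greedy_coloring H l g"
begin

abbreviation T :: "('a \<times> 'b) pair_pre_digraph" where
  "T \<equiv> tensor_product G H"

definition core :: "('a \<times> 'b) set" where
  "core = two_colored_part G f \<times> two_colored_part H g"

lemma pair_graph_T: "pair_graph T"
  using G.pair_graph H.pair_graph by (rule pair_graph_tensor_product)

lemma proper_f: "proper_coloring G k f" and proper_g: "proper_coloring H l g"
  using greedy_f greedy_g by (simp_all add: greedy_coloring_def)

lemma core_closed_nbhd_colors:
  assumes "p \<in> core" "q \<in> closed_nbhd T p"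
  shows "f (fst q) \<in> {1, 2}" "g (snd q) \<in> {1, 2}"
  using assms(1) two_colored_partD[OF _ closed_nbhd_tensor_productD(1)[OF assms(2)], of f]
    two_colored_partD[OF _ closed_nbhd_tensor_productD(2)[OF assms(2)], of g]
  by (simp_all add: core_def mem_Times_iff)

lemma core_arc_colors:
  assumes "p \<in> core" "(p, q) \<in> parcs T"
  shows "f (fst q) = 3 - f (fst p)" "g (snd q) = 3 - g (snd p)"
    "f (fst p) \<in> {1, 2}" "g (snd p) \<in> {1, 2}"
proof -
  have "p \<in> closed_nbhd T p" "q \<in> closed_nbhd T p"
    using assms(2) by (simp_all add: closed_nbhd_def)
  moreover have "f (fst p) \<noteq> f (fst q)" "g (snd p) \<noteq> g (snd q)"
    using assms(2) proper_coloring_arc[OF proper_f] proper_coloring_arc[OF proper_g] by simp_all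
  ultimately show "f (fst q) = 3 - f (fst p)" "g (snd q) = 3 - g (snd p)"
    "f (fst p) \<in> {1, 2}" "g (snd p) \<in> {1, 2}"
    using core_closed_nbhd_colors[OF assms(1), of p] core_closed_nbhd_colors[OF assms(1), of q]
    by auto
qed

lemma core_boundary_sees_mixed_color:
  assumes p: "p \<in> core" and q: "q \<notin> core" and pq: "(p, q) \<in> parcs T"
  obtains n where "n \<notin> core" "(q, n) \<in> parcs T" "f (fst n) \<le> 2 \<longleftrightarrow> \<not> g (snd n) \<le> 2"
proof -
  have low: "f (fst p) \<le> 2" "g (snd p) \<le> 2" "f (fst q) \<le> 2" "g (snd q) \<le> 2"
    using core_arc_colors[OF p pq] by auto
  have qp: "(fst q, fst p) \<in> parcs G" "(snd q, snd p) \<in> parcs H"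
    using pq G.arcs_symmetric H.arcs_symmetric by simp_all
  consider (at_G) "fst q \<notin> two_colored_part G f" | (at_H) "snd q \<notin> two_colored_part H g"
    using q by (auto simp: core_def mem_Times_iff)
  then show ?thesis
  proof cases
    case at_G
    then obtain a where "(fst q, a) \<in> parcs G" "f a \<ge> 3"
      using G.ex_neighbour_color_ge_3[OF proper_f] G.in_arcsD1[OF qp(1)] low by blast
    then show ?thesis
      using that[of "(a, snd p)"] qp low core_closed_nbhd_colors[of "(a, snd p)" "(a, snd p)"]
      by (auto simp: closed_nbhd_def)
  next
    case at_H
    then obtain b where "(snd q, b) \<in> parcs H" "g b \<ge> 3"
      using H.ex_neighbour_color_ge_3[OF proper_g] H.in_arcsD1[OF qp(2)] low by blast
    then show ?thesis
      using that[of "(fst p, b)"] qp low core_closed_nbhd_colors[of "(fst p, b)" "(fst p, b)"]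
      by (auto simp: closed_nbhd_def)
  qed
qed

lemma outside_core_distinguishing_neighbour:
  assumes w: "w \<notin> core" and z: "z \<notin> core" and wz: "(w, z) \<in> parcs T"
  obtains (at_w) n where "n \<notin> core" "(w, n) \<in> parcs T"
    "f (fst n) = f (fst z) \<longleftrightarrow> g (snd n) \<noteq> g (snd z)"
  | (at_z) n where "n \<notin> core" "(z, n) \<in> parcs T"
    "f (fst n) = f (fst w) \<longleftrightarrow> g (snd n) \<noteq> g (snd w)"
proof -
  have wz': "(fst w, fst z) \<in> parcs G" "(snd w, snd z) \<in> parcs H"
    and zw: "(fst z, fst w) \<in> parcs G" "(snd z, snd w) \<in> parcs H"
    using wz G.arcs_symmetric H.arcs_symmetric by simp_all
  consider (at_G) "fst w \<notin> two_colored_part G f \<or> fst z \<notin> two_colored_part G f"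
    | (at_H) "snd w \<notin> two_colored_part H g \<or> snd z \<notin> two_colored_part H g"
    using w by (auto simp: core_def mem_Times_iff)
  then show ?thesis
  proof cases
    case at_G
    show ?thesis
    proof (cases rule: G.greedy_distinguishing_neighbour[OF greedy_f wz'(1) at_G,
          case_names at_u at_v])
      case (at_u n)
      then show ?thesis
        using at_w[of "(n, snd z)"] wz' by (simp add: core_def)
    next
      case (at_v n)
      then show ?thesis
        using at_z[of "(n, snd w)"] zw by (simp add: core_def)
    qed
  next
    case at_H
    show ?thesis
    proof (cases rule: H.greedy_distinguishing_neighbour[OF greedy_g wz'(2) at_H,
          case_names at_u at_v])
      case (at_u n)
      then show ?thesis
        using at_w[of "(fst z, n)"] wz' by (simp add: core_def)
    next
      case (at_v n)
      then show ?thesis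
        using at_z[of "(fst w, n)"] zw by (simp add: core_def)
    qed
  qed
qed

end

locale greedy_core_levelling = greedy_coloring_pair G H k l f g
  for G :: "'a pair_pre_digraph" and H :: "'b pair_pre_digraph" and k l f g +
  fixes L :: "'a \<times> 'b \<Rightarrow> nat"
  assumes levelling_L: "levelling T core L"
    and odd_level: "\<And>p. odd (L p) \<longleftrightarrow> even (f (fst p))"
    and level_outside: "\<And>p. p \<notin> core \<Longrightarrow> L p \<le> 1"
begin

definition recoloring :: "'a \<times> 'b \<Rightarrow> nat \<times> nat" where
  "recoloring p =
     (if p \<in> core \<and> L p mod 4 = 2 then (3, 3)
      else if p \<in> core \<and> L p mod 4 = 3 then (1, g (snd p))
      else (f (fst p), g (snd p)))"

lemma recoloring_outside [simp]: "p \<notin> core \<Longrightarrow> recoloring p = (f (fst p), g (snd p))"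
  by (simp add: recoloring_def)

text \<open>
  Around a vertex of the core, \<open>f + g\<close> has a constant parity, and besides level 2, marked by
  \<open>(3, 3)\<close>, only level 3 deviates from it. So the level modulo 4 can be read off the color.
\<close>

definition level_of_color :: "bool \<Rightarrow> nat \<times> nat \<Rightarrow> nat" where
  "level_of_color e x =
     (if fst x = 3 then 2 else if odd (fst x + snd x) = e then fst x - 1 else 3)"

lemma level_of_color_recoloring:
  assumes p: "p \<in> core" and q: "q \<in> closed_nbhd T p"
  shows "level_of_color (odd (f (fst p) + g (snd p))) (recoloring q) = L q mod 4"
proof -
  have parity: "odd (f (fst p) + g (snd p)) = odd (f (fst q) + g (snd q))"
    using q core_arc_colors[OF p, of q] by (auto simp: closed_nbhd_def)
  have colors: "f (fst q) \<in> {1, 2}" "g (snd q) \<in> {1, 2}"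
    using core_closed_nbhd_colors[OF p q] by auto
  have "L q mod 4 < 4"
    by simp
  then have "L q mod 4 \<in> {0, 1, 2, 3}"
    by auto
  moreover have "odd (L q mod 4) \<longleftrightarrow> odd (L q)"
    by (subst dvd_mod_iff) simp_all
  ultimately have level: "L q mod 4 \<in> {f (fst q) - 1, f (fst q) + 1}"
    using colors(1) odd_level[of q] by auto
  show ?thesis
  proof (cases "q \<in> core")
    case True
    then show ?thesis
      using level colors unfolding parity by (auto simp: recoloring_def level_of_color_def)
  next
    case False
    then show ?thesis
      using level colors level_outside[OF False] unfolding parity
      by (auto simp: level_of_color_def)
  qed
qed

lemma recoloring_core_arc:
  assumes p: "p \<in> core" and pq: "(p, q) \<in> parcs T"
  shows "recoloring p \<noteq> recoloring q"
proof
  assume "recoloring p = recoloring q"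
  then have "L p mod 4 = L q mod 4"
    using level_of_color_recoloring[OF p, of p] level_of_color_recoloring[OF p, of q] pq
    by (simp add: closed_nbhd_def)
  then show False
    using levelling_mod_4_arc[OF levelling_L p pq] by simp
qed

lemma recoloring_lid_in_core:
  assumes p: "p \<in> core" and q: "q \<in> core"
    and arcs: "(p, q) \<in> parcs T" "(q, p) \<in> parcs T"
  shows "recoloring ` closed_nbhd T p \<noteq> recoloring ` closed_nbhd T q"
proof
  let ?level = "level_of_color (odd (f (fst p) + g (snd p)))"
  assume "recoloring ` closed_nbhd T p = recoloring ` closed_nbhd T q"
  then have "(\<lambda>x. ?level (recoloring x)) ` closed_nbhd T p =
      (\<lambda>x. ?level (recoloring x)) ` closed_nbhd T q"
    by (metis image_image)
  moreover have "odd (f (fst p) + g (snd p)) = odd (f (fst q) + g (snd q))"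
    using core_arc_colors[OF p arcs(1)] by auto
  ultimately have "(\<lambda>x. L x mod 4) ` closed_nbhd T p = (\<lambda>x. L x mod 4) ` closed_nbhd T q"
    using level_of_color_recoloring[OF p] level_of_color_recoloring[OF q] by (simp cong: image_cong)
  then show False
    using levelling_mod_4_closed_nbhd[OF levelling_L p q arcs] by simp
qed

lemma core_sees_no_mixed_color:
  assumes "p \<in> core" "x \<in> recoloring ` closed_nbhd T p"
  shows "fst x \<le> 2 \<longleftrightarrow> snd x \<le> 2"
  using assms core_closed_nbhd_colors[OF assms(1)] by (fastforce simp: recoloring_def)

lemma recoloring_lid_core_boundary:
  assumes "p \<in> core" "q \<notin> core" "(p, q) \<in> parcs T"
  shows "recoloring ` closed_nbhd T p \<noteq> recoloring ` closed_nbhd T q"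
proof -
  obtain n where n: "n \<notin> core" "(q, n) \<in> parcs T" "f (fst n) \<le> 2 \<longleftrightarrow> \<not> g (snd n) \<le> 2"
    using core_boundary_sees_mixed_color assms by blast
  have "recoloring n \<in> recoloring ` closed_nbhd T q"
    using n(2) by (simp add: closed_nbhd_def)
  moreover have "recoloring n \<notin> recoloring ` closed_nbhd T p"
    using core_sees_no_mixed_color[OF assms(1), of "recoloring n"] n(1,3) by auto
  ultimately show ?thesis
    by blast
qed

lemma recoloring_core_boundary:
  assumes q: "q \<in> core" and "z \<notin> core" and qz: "(q, z) \<in> parcs T"
  shows "recoloring q = (3, 3) \<or> recoloring q = (f (fst q), g (snd q))"
proof -
  have "L q = 1 \<or> L q = 2"
    using levelling_arc[OF levelling_L q qz] levelling_pos[OF levelling_L q]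
      level_outside[OF assms(2)] by auto
  then show ?thesis
    by (auto simp: recoloring_def)
qed

lemma recoloring_neighbour_outside:
  assumes z: "z \<notin> core" and zq: "(z, q) \<in> parcs T"
  shows "fst (recoloring q) \<noteq> f (fst z)" "snd (recoloring q) \<noteq> g (snd z)"
proof -
  have product_color: "f (fst q) \<noteq> f (fst z)" "g (snd q) \<noteq> g (snd z)"
    using zq proper_coloring_arc[OF proper_f] proper_coloring_arc[OF proper_g] by fastforce+
  have "recoloring q = (f (fst q), g (snd q)) \<or>
      recoloring q = (3, 3) \<and> f (fst z) \<noteq> 3 \<and> g (snd z) \<noteq> 3"
  proof (cases "q \<in> core")
    case True
    have qz: "(q, z) \<in> parcs T"
      using zq G.arcs_symmetric H.arcs_symmetric by simp
    then show ?thesis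
      using recoloring_core_boundary[OF True z qz] core_arc_colors[OF True qz] by auto
  qed simp
  then show "fst (recoloring q) \<noteq> f (fst z)" "snd (recoloring q) \<noteq> g (snd z)"
    using product_color by auto
qed

lemma recoloring_lid_if_shared_coordinate:
  assumes z: "z \<notin> core" and n: "n \<notin> core" "(w, n) \<in> parcs T"
    and shared: "f (fst n) = f (fst z) \<longleftrightarrow> g (snd n) \<noteq> g (snd z)"
  shows "recoloring ` closed_nbhd T w \<noteq> recoloring ` closed_nbhd T z"
proof -
  have "recoloring n \<in> recoloring ` closed_nbhd T w"
    using n(2) by (simp add: closed_nbhd_def)
  moreover have "recoloring n \<noteq> recoloring q" if q: "q \<in> closed_nbhd T z" for q
  proof
    assume "recoloring n = recoloring q"
    then have "recoloring q = (f (fst n), g (snd n))"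
      using recoloring_outside[OF n(1)] by simp
    moreover have "q = z \<or> (z, q) \<in> parcs T"
      using q by (auto simp: closed_nbhd_def)
    ultimately show False
      using recoloring_neighbour_outside[OF z, of q] recoloring_outside[OF z] shared by auto
  qed
  ultimately show ?thesis
    by blast
qed

lemma recoloring_lid_outside_core:
  assumes w: "w \<notin> core" and z: "z \<notin> core" and wz: "(w, z) \<in> parcs T"
  shows "recoloring ` closed_nbhd T w \<noteq> recoloring ` closed_nbhd T z"
  using outside_core_distinguishing_neighbour[OF w z wz]
    recoloring_lid_if_shared_coordinate[OF z] recoloring_lid_if_shared_coordinate[OF w] by metis

lemma lid_chromatic_number_T_le:
  assumes "k \<ge> 3" "l \<ge> 3"
  shows "lid_chromatic_number T \<le> k * l"
proof -
  interpret T: pair_graph T by (rule pair_graph_T)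
  have "lid_chromatic_number T \<le> card ({1..k} \<times> {1..l})"
  proof (rule T.lid_chromatic_number_le_card[where c = recoloring])
    show "recoloring ` pverts T \<subseteq> {1..k} \<times> {1..l}"
      using assms proper_coloring_range[OF proper_f] proper_coloring_range[OF proper_g]
      by (auto simp: recoloring_def)
  next
    fix p q assume pq: "(p, q) \<in> parcs T"
    note qp = T.arcs_symmetric[OF pq]
    show "recoloring p \<noteq> recoloring q"
      using recoloring_core_arc[of p q] recoloring_core_arc[of q p] pq qp
        recoloring_neighbour_outside(1)[OF _ pq] by (metis fst_conv recoloring_outside)
    show "recoloring ` closed_nbhd T p \<noteq> recoloring ` closed_nbhd T q"
      using recoloring_lid_in_core[of p q] recoloring_lid_core_boundary[of p q]
        recoloring_lid_core_boundary[of q p] recoloring_lid_outside_core[of p q] pq qp by metis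
  qed simp
  then show ?thesis
    by simp
qed

end

lemma lid_chromatic_number_tensor_product_le_if_not_bipartite:
  assumes G: "pair_graph G" and H: "pair_graph H"
    and conn: "Digraph_Component.connected (with_proj G)"
    and neighbour: "\<And>v. v \<in> pverts H \<Longrightarrow> \<exists>w. (v, w) \<in> parcs H"
    and three: "chromatic_number G \<ge> 3" "chromatic_number H \<ge> 3"
  shows "lid_chromatic_number (tensor_product G H) \<le> chromatic_number G * chromatic_number H"
proof -
  interpret G: pair_graph G by fact
  interpret H: pair_graph H by fact
  obtain f g where greedy: "greedy_coloring G (chromatic_number G) f"
    "greedy_coloring H (chromatic_number H) g"
    using G.proper_coloring_chromatic_number G.greedy_coloring_exists
      H.proper_coloring_chromatic_number H.greedy_coloring_exists by metis
  interpret greedy_coloring_pair G H "chromatic_number G" "chromatic_number H" f g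
    by unfold_locales (rule greedy)+
  interpret T: pair_graph T by (rule pair_graph_T)
  obtain r where r: "r \<in> pverts G" "r \<notin> two_colored_part G f"
    using two_colored_part_neq_pverts[OF proper_f] three(1) by (auto simp: two_colored_part_def)
  obtain L where "levelling T core L" "\<And>p. odd (L p) \<longleftrightarrow> even (f (fst p))"
    "\<And>p. p \<notin> core \<Longrightarrow> L p \<le> 1"
  proof (rule T.levelling_exists[where S = core and P = "\<lambda>p. even (f (fst p))"])
    fix p assume "p \<in> core"
    then have p: "fst p \<in> pverts G" "snd p \<in> pverts H"
      by (auto simp: core_def two_colored_part_def)
    obtain b where "(p, (r, b)) \<in> (parcs T)\<^sup>*"
      using tensor_product_rtrancl_lift[OF G.connected_rtrancl[OF conn p(1) r(1)] p(2)
          H.pair_wf_digraph neighbour] by auto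
    then show "\<exists>q. q \<notin> core \<and> (p, q) \<in> (parcs T)\<^sup>*"
      using r(2) by (auto simp: core_def)
  next
    fix p q assume "p \<in> core" "(p, q) \<in> parcs T"
    then show "even (f (fst p)) \<noteq> even (f (fst q))"
      using core_arc_colors[of p q] by auto
  qed blast
  then interpret greedy_core_levelling G H "chromatic_number G" "chromatic_number H" f g L
    by unfold_locales
  show ?thesis
    using three by (rule lid_chromatic_number_T_le)
qed

theorem theorem7:
  fixes G :: "'a pair_pre_digraph" and H :: "'b pair_pre_digraph"
  assumes "pair_graph G" and "pair_graph H"
    and "Digraph_Component.connected (with_proj G)" and "Digraph_Component.connected (with_proj H)"
    and "card (pverts G) \<ge> 2" and "card (pverts H) \<ge> 2"
    and "card (pverts G) \<ge> 3 \<or> card (pverts H) \<ge> 3"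
  shows "lid_chromatic_number (tensor_product G H) \<le> chromatic_number G * chromatic_number H"
proof -
  interpret G: pair_graph G by fact
  interpret H: pair_graph H by fact
  note neighbour_G = G.connected_has_neighbour[OF assms(3,5)]
    and neighbour_H = H.connected_has_neighbour[OF assms(4,6)]
  have "pverts G \<noteq> {}" "pverts H \<noteq> {}"
    using assms(5,6) by auto
  then have ge_2: "chromatic_number G \<ge> 2" "chromatic_number H \<ge> 2"
    using neighbour_G neighbour_H G.chromatic_number_ge_2 H.chromatic_number_ge_2 by blast+
  show ?thesis
  proof (cases "chromatic_number G = 2 \<or> chromatic_number H = 2")
    case True
    then have "lid_chromatic_number (tensor_product G H) \<le> 4"
      by (rule lid_chromatic_number_tensor_product_le_4_if_bipartite[OF assms(1,2)])
    also have "4 \<le> chromatic_number G * chromatic_number H"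
      using mult_le_mono[OF ge_2] by simp
    finally show ?thesis .
  next
    case False
    then have "chromatic_number G \<ge> 3" "chromatic_number H \<ge> 3"
      using ge_2 by linarith+
    then show ?thesis
      using lid_chromatic_number_tensor_product_le_if_not_bipartite[OF assms(1-3)] neighbour_H
      by blast
  qed
qed

end
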